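(* Assume that $\mathbb{H}_0(\Omega)\cup\mathbb{H}_1(\Omega)\subset\Omega$. If $\alpha\in\Omega\cap U$, then the girth of $\Gamma(\Omega,q)$ is at least $2(|\alpha|+3)$.
   Context: Let $q$ be a prime power and $\mathbb{F}_q$ the field with $q$ elements. $\{0,1\}^*$ is the set of finite binary sequences, $\eta$ the null sequence; juxtaposition is concatenation; $|\alpha|$ is the length of $\alpha$. $\Omega\subset\{0,1\}^*$ is a finite set satisfying condition C1: $\eta\in\Omega$, and for any $\alpha\in\Omega\setminus\{\eta\}$ the sequence obtained by deleting the last bit of $\alpha$ is in $\Omega$. $L(\Omega)$ and $R(\Omega)$ are two disjoint copies of $\mathbb{F}_q^{|\Omega|+1}$; their vectors are written $[l]$ and $\langle r\rangle$ respectively, with entries indexed by $\Omega\cup\{*\}$, where $*\notin\Omega$ is an extra symbol. $\Gamma(\Omega,q)$ is the bipartite graph with vertex set $L(\Omega)\cup R(\Omega)$ in which $[l]\in L(\Omega)$ and $\langle r\rangle\in R(\Omega)$ are adjacent if and only if $l_\eta+r_\eta=l_*r_*$, $l_{\alpha0}+r_{\alpha0}=r_*l_\alpha$ for all $\alpha0\in\Omega$, and $l_{\beta1}+r_{\beta1}=l_*r_\beta$ for all $\beta1\in\Omega$ (here $\alpha,\beta\in\{0,1\}^*$). For $a\in\{0,1\}$, $\mathbb{H}_a(\Omega)$ is the set of all binary sequences obtained from sequences in $\Omega$ by a finite number (possibly zero) of iterated deletions, each of which deletes a symbol $a$ either from the first position (when the first bit is $a$) or from two consecutive $a$'s (replacing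 some block $aa$ by $a$). $U=\{\eta,0,1,01,10,010,101,0101,1010,\ldots\}$ is the set of all alternating binary sequences (no two consecutive bits equal), including $\eta$. *)

theory Defs
  imports "HOL-Library.FuncSet" "HOL-Library.Extended_Nat"
begin

section \<open>Girth of a simple graph\<close>

text \<open>A simple graph is a pair of a vertex set and a set of edges, each edge being a set of two
  vertices.\<close>

type_synonym 'v ugraph = "'v set \<times> 'v set set"

text \<open>A cycle is given by the cyclic list of its pairwise distinct vertices, so its length as a
  cycle (number of edges) is the length of the list.\<close>

definition is_cycle :: "'v ugraph \<Rightarrow> 'v list \<Rightarrow> bool" where
  "is_cycle G vs \<longleftrightarrow>
     3 \<le> length vs \<and> distinct vs \<and> set vs \<subseteq> fst G \<and>
     (\<forall>i < length vs. {vs ! i, vs ! (Suc i mod length vs)} \<in> snd G)"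

text \<open>The infimum over the empty set is \<open>\<infinity>\<close>, so acyclic graphs have infinite girth.\<close>

definition girth :: "'v ugraph \<Rightarrow> enat" where
  "girth G = Inf {enat (length vs) | vs. is_cycle G vs}"


section \<open>Binary sequences\<close>

text \<open>The bits 0 and 1 are \<open>False\<close> and \<open>True\<close>; the head of the list is the first bit.\<close>

type_synonym bitseq = "bool list"

definition condition_C1 :: "bitseq set \<Rightarrow> bool" where
  "condition_C1 \<Omega> \<longleftrightarrow> [] \<in> \<Omega> \<and> (\<forall>\<alpha> \<in> \<Omega> - {[]}. butlast \<alpha> \<in> \<Omega>)"

inductive deletion :: "bool \<Rightarrow> bitseq \<Rightarrow> bitseq \<Rightarrow> bool" for a :: bool where
  first: "deletion a (a # w) w"
| double: "deletion a (u @ [a, a] @ v) (u @ [a] @ v)"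

definition HH :: "bool \<Rightarrow> bitseq set \<Rightarrow> bitseq set" where
  "HH a \<Omega> = {\<beta>. \<exists>\<alpha> \<in> \<Omega>. (deletion a)\<^sup>*\<^sup>* \<alpha> \<beta>}"

definition U :: "bitseq set" where
  "U = {\<alpha>. distinct_adj \<alpha>}"


section \<open>The graph\<close>

text \<open>A vector with entries indexed by \<open>\<Omega> \<union> {*}\<close> is an extensional function on the index set
  below, where \<open>None\<close> plays the role of \<open>*\<close>.\<close>

definition index_set :: "bitseq set \<Rightarrow> bitseq option set" where
  "index_set \<Omega> = insert None (Some ` \<Omega>)"

definition vectors :: "bitseq set \<Rightarrow> (bitseq option \<Rightarrow> 'a) set" where
  "vectors \<Omega> = index_set \<Omega> \<rightarrow>\<^sub>E UNIV"

definition adjacent ::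
  "bitseq set \<Rightarrow> (bitseq option \<Rightarrow> 'a::field) \<Rightarrow> (bitseq option \<Rightarrow> 'a) \<Rightarrow> bool" where
  "adjacent \<Omega> l r \<longleftrightarrow>
     l (Some []) + r (Some []) = l None * r None \<and>
     (\<forall>\<alpha>. \<alpha> @ [False] \<in> \<Omega> \<longrightarrow>
        l (Some (\<alpha> @ [False])) + r (Some (\<alpha> @ [False])) = r None * l (Some \<alpha>)) \<and>
     (\<forall>\<beta>. \<beta> @ [True] \<in> \<Omega> \<longrightarrow>
        l (Some (\<beta> @ [True])) + r (Some (\<beta> @ [True])) = l None * r (Some \<beta>))"

text \<open>The disjoint copies \<open>L(\<Omega>)\<close> and \<open>R(\<Omega>)\<close> are the two summands of \<open>vectors \<Omega> <+> vectors \<Omega>\<close>.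
  The field, and with it \<open>q = CARD('a)\<close>, is determined by the type \<open>'a\<close>.\<close>

definition Gamma ::
  "bitseq set \<Rightarrow> 'a::{field, finite} itself \<Rightarrow>
    ((bitseq option \<Rightarrow> 'a) + (bitseq option \<Rightarrow> 'a)) ugraph" where
  "Gamma \<Omega> _ =
     (vectors \<Omega> <+> vectors \<Omega>,
      {{Inl l, Inr r} | l r. l \<in> vectors \<Omega> \<and> r \<in> vectors \<Omega> \<and> adjacent \<Omega> l r})"

end

theory Submission imports Defs begin

text \<open>
  Moving along a walk of the graph replaces the edges \<open>{l, r}\<close> one after another, each time keeping
  one endpoint. A step with \<open>r\<close> kept is of type \<open>1\<close> and has the value \<open>l'\<^sub>* - l\<^sub>*\<close>; a step with
  \<open>l\<close> kept is of type \<open>0\<close> and has the value \<open>r'\<^sub>* - r\<^sub>*\<close>. A vertex and the colour \<open>*\<close> of a neighbour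
  determine that neighbour, so the steps of a cycle have nonzero values, and their types alternate.

  The idea is to read the coordinates of an edge along alternating words. The word \<open>1\<close> stands for
  \<open>l\<^sub>*\<close>, the word \<open>0\<close> for \<open>r\<^sub>*\<close>, and an alternating word \<open>w\<close> of length at least two stands for the
  coordinate at \<open>w\<close> without its first two bits, taken from \<open>l\<close> if \<open>w\<close> ends in \<open>1\<close> and from \<open>r\<close> if it
  ends in \<open>0\<close> (\<open>coord\<close>). With this choice the adjacency equations become one linear rule
  (\<open>coord_step_left\<close>, \<open>coord_step_right\<close>): a step of type \<open>t\<close> and value \<open>a\<close> adds \<open>a\<close> times
  the coordinate at \<open>v\<close> to the coordinate at \<open>v t\<close> and changes nothing else. Hence the coordinates at
  the end of a walk are a convolution of those at its start with the iterated sums of the step values,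
  that is, with the coefficients of the noncommutative product \<open>\<Prod>(1 + a\<^sub>i X\<^bsub>t\<^sub>i\<^esub>)\<close> (\<open>magnus\<close>,
  \<open>magnus_transport\<close>). For a closed walk, induction on the length of the word shows that these
  coefficients vanish at all nonempty words that stand for a coordinate
  (\<open>closed_walk_magnus_zero\<close>). The induction passes to suffixes of the word, and this is where closure
  of \<open>\<Omega>\<close> under the deletions enters: an alternating sequence may lose its first bit.

  Let a cycle now have length \<open>2m\<close> with \<open>m \<le> |\<alpha>| + 2\<close>. Putting two bits in front of \<open>\<alpha>\<close> and cutting
  down to length \<open>m\<close> gives an alternating word \<open>w\<close> all of whose prefixes stand for coordinates. Start
  the cycle with a step of the type of the first bit of \<open>w\<close> and cut its \<open>2m\<close> steps into halves
  \<open>s\<close>, \<open>s'\<close>. As the product of all steps has no nontrivial coefficient at prefixes of \<open>w\<close>, the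
  products of \<open>s\<close> and of the inverse of \<open>s'\<close> agree at \<open>w\<close>. But both have exactly \<open>m\<close> factors: the
  types of \<open>s\<close> spell \<open>w\<close>, giving the nonzero product of the step values, whereas the types of the
  inverse of \<open>s'\<close> begin with the wrong letter, giving \<open>0\<close> (\<open>magnus_obstruction\<close>).
\<close>

section \<open>Coefficients of noncommutative products\<close>

text \<open>The coefficient of the word \<open>w\<close> in the product, in order, of the factors \<open>1 + a X\<^sub>t\<close> for the
  entries \<open>(t, a)\<close> of \<open>s\<close>, with noncommuting variables \<open>X\<^sub>t\<close>. Equivalently, the sum over all ways
  of spelling \<open>w\<close> by a subsequence of \<open>s\<close> of the product of the values used.\<close>

fun magnus :: "('b \<times> 'a::comm_ring_1) list \<Rightarrow> 'b list \<Rightarrow> 'a" where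
  "magnus s [] = 1"
| "magnus [] (c # w) = 0"
| "magnus (x # s) (c # w) = magnus s (c # w) + (if c = fst x then snd x * magnus s w else 0)"

lemma magnus_Nil: "magnus [] w = (if w = [] then 1 else 0)"
  by (cases w) auto

text \<open>The definition splits off the first factor; the last one is needed since a step of a walk acts
  on the last letter of a word.\<close>

lemma magnus_snoc:
  "magnus (s @ [x]) (w @ [c]) = magnus s (w @ [c]) + (if c = fst x then snd x * magnus s w else 0)"
proof (induction s arbitrary: w)
  case Nil
  show ?case by (cases w) (auto simp: magnus_Nil)
next
  case (Cons y s)
  show ?case
  proof (cases w)
    case Nil
    have "magnus (s @ [x]) ([] @ [c]) =
        magnus s ([] @ [c]) + (if c = fst x then snd x * magnus s [] else 0)"
      by (rule Cons.IH)
    then show ?thesis using Nil by (auto simp: algebra_simps)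
  next
    case (Cons d v)
    have 1: "magnus (s @ [x]) (d # (v @ [c])) =
        magnus s (d # (v @ [c])) + (if c = fst x then snd x * magnus s (d # v) else 0)"
      using Cons.IH[of "d # v"] by simp
    show ?thesis using 1 Cons.IH[of v] Cons by (auto simp: algebra_simps)
  qed
qed

lemma magnus_long: "length s < length w \<Longrightarrow> magnus s w = 0"
  by (induction s w rule: magnus.induct) auto

text \<open>If there are as many factors as letters, only the choice of the variable in every factor can
  contribute.\<close>

lemma magnus_same_length:
  "length s = length w \<Longrightarrow> magnus s w = (if map fst s = w then prod_list (map snd s) else 0)"
  by (induction s w rule: magnus.induct) (auto simp: magnus_long)

text \<open>A function on words that evolves by multiplication on the right with \<open>1 + a\<^sub>i X\<^bsub>t\<^sub>i\<^esub>\<close> is,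
  after \<open>n\<close> steps, the initial function times the product of the factors. The rule is required on a
  set \<open>P\<close> of words only, which has to be closed under removal of the last letter because the value at a
  word depends on the values at its prefixes.\<close>

lemma magnus_transport:
  fixes f :: "nat \<Rightarrow> 'b list \<Rightarrow> 'a::comm_ring_1"
  assumes closed: "\<And>v c. v @ [c] \<in> P \<Longrightarrow> v \<in> P"
    and empty: "\<And>i. f (Suc i) [] = f i []"
    and step: "\<And>i v c. i < n \<Longrightarrow> v @ [c] \<in> P \<Longrightarrow>
      f (Suc i) (v @ [c]) = f i (v @ [c]) + (if c = t i then a i * f i v else 0)"
    and "w \<in> P"
  shows "f n w = (\<Sum>j\<le>length w.
    f 0 (take j w) * magnus (map (\<lambda>i. (t i, a i)) [0..<n]) (drop j w))"
  using step \<open>w \<in> P\<close>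
proof (induction n arbitrary: w)
  case 0
  have "(\<Sum>j\<le>length w. f 0 (take j w) * magnus [] (drop j w)) =
      (\<Sum>j\<le>length w. if j = length w then f 0 w else 0)"
    by (rule sum.cong) (auto simp: magnus_Nil)
  then show ?case by simp
next
  case (Suc n)
  let ?s = "map (\<lambda>i. (t i, a i)) [0..<n]"
  have IH: "f n v = (\<Sum>j\<le>length v. f 0 (take j v) * magnus ?s (drop j v))" if "v \<in> P" for v
    using Suc.IH[of v] Suc.prems(1) that by simp
  show ?case
  proof (cases w rule: rev_cases)
    case Nil
    then show ?thesis using IH[of "[]"] Suc.prems(2) empty by simp
  next
    case (snoc v c)
    have v: "v \<in> P" using closed Suc.prems(2) snoc by blast
    have "f (Suc n) w = f n w + (if c = t n then a n * f n v else 0)"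
      using Suc.prems snoc by simp
    also have "\<dots> = (\<Sum>j\<le>length v. f 0 (take j v) * (magnus ?s (drop j v @ [c])
        + (if c = t n then a n * magnus ?s (drop j v) else 0))) + f 0 w"
      using IH[OF v] IH[OF Suc.prems(2)] snoc
      by (auto simp: sum_distrib_left sum.distrib algebra_simps)
    also have "\<dots> = (\<Sum>j\<le>length v. f 0 (take j v) *
        magnus (?s @ [(t n, a n)]) (drop j v @ [c])) + f 0 w"
      unfolding magnus_snoc fst_conv snd_conv by simp
    finally show ?thesis using snoc by simp
  qed
qed

lemma magnus_append:
  "magnus (s @ s') w = (\<Sum>j\<le>length w. magnus s (take j w) * magnus s' (drop j w))"
proof -
  have eq: "map (\<lambda>i. (fst (s' ! i), snd (s' ! i))) [0..<length s'] = s'"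
    by (simp add: map_nth)
  have "magnus (s @ take (length s') s') w = (\<Sum>j\<le>length w. magnus (s @ take 0 s') (take j w) *
      magnus (map (\<lambda>i. (fst (s' ! i), snd (s' ! i))) [0..<length s']) (drop j w))"
    by (rule magnus_transport[where P = UNIV and f = "\<lambda>i. magnus (s @ take i s')"])
      (simp_all add: take_Suc_conv_app_nth magnus_snoc flip: append_assoc)
  then show ?thesis unfolding eq by simp
qed

text \<open>This inverts the product only modulo the words with a repeated adjacent letter, since
  \<open>(1 + a X)(1 - a X) = 1 - a\<^sup>2 X\<^sup>2\<close>.\<close>

definition inverse_steps :: "('b \<times> 'a::comm_ring_1) list \<Rightarrow> ('b \<times> 'a) list" where
  "inverse_steps s = rev (map (\<lambda>(t, a). (t, - a)) s)"

lemma distinct_adj_butlast: "distinct_adj (v @ [c]) \<Longrightarrow> distinct_adj v"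
  by (simp add: distinct_adj_append_iff)

lemma magnus_cancel:
  assumes "distinct_adj w"
  shows "magnus (s @ [(t, a), (t, - a)]) w = magnus s w"
proof (cases w rule: rev_cases)
  case (snoc v c)
  have eq: "magnus (s @ [(t, a)]) v = magnus s v" if "c = t"
  proof (cases v rule: rev_cases)
    case (snoc u d)
    then have "d \<noteq> t" using assms \<open>w = v @ [c]\<close> that by (simp add: distinct_adj_append_iff)
    then show ?thesis using snoc by (simp add: magnus_snoc)
  qed simp
  have "magnus ((s @ [(t, a)]) @ [(t, - a)]) w = magnus s w"
    unfolding snoc magnus_snoc using eq by auto
  then show ?thesis by simp
qed simp

lemma magnus_append_inverse:
  assumes "distinct_adj w"
  shows "magnus (s @ s' @ inverse_steps s') w = magnus s w"
  using assms
proof (induction s' arbitrary: s w)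
  case Nil
  then show ?case by (simp add: inverse_steps_def)
next
  case (Cons x s')
  obtain t a where x: "x = (t, a)" by fastforce
  let ?A = "(s @ [x]) @ s' @ inverse_steps s'"
  have "magnus (?A @ [(t, - a)]) w = magnus ((s @ [x]) @ [(t, - a)]) w"
  proof (cases w rule: rev_cases)
    case (snoc v c)
    then show ?thesis
      using Cons.IH[of w "s @ [x]"] Cons.IH[of v "s @ [x]"] Cons.prems distinct_adj_butlast[of v c]
      unfolding snoc magnus_snoc by simp
  qed simp
  then show ?case using magnus_cancel[OF Cons.prems, of s t a] x by (simp add: inverse_steps_def)
qed

text \<open>If the product \<open>s s'\<close> is trivial at all prefixes of \<open>w\<close>, multiplication by the inverse of \<open>s'\<close>
  shows that \<open>s\<close> and this inverse have the same coefficient at \<open>w\<close>. The first coefficient is the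
  product of the values of \<open>s\<close>. The second is zero, as the factors of the inverse are as many as the
  letters of \<open>w\<close> and begin with the last type of \<open>s'\<close>, which is not the first letter of \<open>w\<close>.\<close>

lemma magnus_obstruction:
  fixes s s' :: "('b \<times> 'a::idom) list"
  assumes adj: "distinct_adj w" and "w \<noteq> []"
    and len: "length s = length w" "length s' = length w"
    and s: "map fst s = w" "0 \<notin> snd ` set s"
    and s': "fst (last s') \<noteq> hd w"
  shows "\<exists>j \<in> {1..length w}. magnus (s @ s') (take j w) \<noteq> 0"
proof (rule ccontr)
  assume "\<not> ?thesis"
  then have zero: "magnus (s @ s') (take j w) = 0" if "j \<noteq> 0" "j \<le> length w" for j
    using that by auto
  have "magnus s w = magnus ((s @ s') @ inverse_steps s') w"
    using magnus_append_inverse[OF adj, of s s'] by simp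
  also have "\<dots> = (\<Sum>j\<le>length w. if j = 0 then magnus (inverse_steps s') w else 0)"
    unfolding magnus_append[of "s @ s'"] by (rule sum.cong) (auto simp: zero)
  also have "\<dots> = magnus (inverse_steps s') w" by simp
  also have "\<dots> = 0"
  proof -
    have ne: "s' \<noteq> []" using \<open>w \<noteq> []\<close> len by auto
    have "hd (map fst (inverse_steps s')) = fst (last s')"
      using ne by (simp add: inverse_steps_def rev_map[symmetric] hd_rev last_map case_prod_beta)
    then have "map fst (inverse_steps s') \<noteq> w" using s' by auto
    then show ?thesis using len by (simp add: magnus_same_length inverse_steps_def)
  qed
  finally have "prod_list (map snd s) = 0" using len s by (simp add: magnus_same_length)
  then show False using s by (auto simp: prod_list_zero_iff)
qed

section \<open>Coordinates of an edge indexed by words\<close>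

text \<open>The value \<open>1\<close> at the empty word makes the change of \<open>l\<^sub>*\<close> in a step an instance of the rule
  for longer words. The two words of length two encode \<open>l\<^sub>\<eta>\<close> (as \<open>01\<close>) and \<open>r\<^sub>\<eta>\<close> (as \<open>10\<close>): the
  first increases by \<open>r\<^sub>*\<close> times the change of \<open>l\<^sub>*\<close>, the second by \<open>l\<^sub>*\<close> times the change of
  \<open>r\<^sub>*\<close>.\<close>

definition coord ::
  "(bitseq option \<Rightarrow> 'a::field) \<Rightarrow> (bitseq option \<Rightarrow> 'a) \<Rightarrow> bitseq \<Rightarrow> 'a" where
  "coord l r w = (if w = [] then 1
     else (if last w then l else r) (if length w = 1 then None else Some (drop 2 w)))"

text \<open>The words that stand for a coordinate. Those of length at most two are covered if
  \<open>\<eta> \<in> \<Omega>\<close>.\<close>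

definition words :: "bitseq set \<Rightarrow> bitseq set" where
  "words \<Omega> = {w. distinct_adj w \<and> drop 2 w \<in> \<Omega>}"

lemma C1_butlast: "condition_C1 \<Omega> \<Longrightarrow> v @ [c] \<in> \<Omega> \<Longrightarrow> v \<in> \<Omega>"
  unfolding condition_C1_def by (metis DiffI append_is_Nil_conv butlast_snoc not_Cons_self2 singletonD)

lemma C1_take: "condition_C1 \<Omega> \<Longrightarrow> w \<in> \<Omega> \<Longrightarrow> take k w \<in> \<Omega>"
proof (induction w rule: rev_induct)
  case (snoc c v)
  then show ?case using C1_butlast[of \<Omega> v c] by (cases "k \<le> length v") auto
qed simp

lemma HH_tl:
  assumes "HH False \<Omega> \<union> HH True \<Omega> \<subseteq> \<Omega>" "c # w \<in> \<Omega>"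
  shows "w \<in> \<Omega>"
proof -
  have "w \<in> HH c \<Omega>" unfolding HH_def using assms(2) deletion.first by blast
  then show ?thesis using assms(1) by (cases c) auto
qed

lemma words_butlast:
  assumes "condition_C1 \<Omega>" "v @ [c] \<in> words \<Omega>"
  shows "v \<in> words \<Omega>"
proof -
  have "drop 2 v = take (length v - 2) (drop 2 (v @ [c]))" by simp
  then show ?thesis using C1_take[OF assms(1)] assms(2) distinct_adj_butlast[of v c]
    unfolding words_def by (metis mem_Collect_eq)
qed

lemma words_take: "condition_C1 \<Omega> \<Longrightarrow> w \<in> words \<Omega> \<Longrightarrow> take k w \<in> words \<Omega>"
proof (induction w rule: rev_induct)
  case (snoc c v)
  then show ?case using words_butlast[of \<Omega> v c] by (cases "k \<le> length v") auto
qed simp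

lemma words_drop:
  assumes "condition_C1 \<Omega>" "HH False \<Omega> \<union> HH True \<Omega> \<subseteq> \<Omega>" "w \<in> words \<Omega>"
  shows "drop k w \<in> words \<Omega>"
proof (induction k)
  case (Suc k)
  show ?case
  proof (cases "drop k w")
    case (Cons c v)
    have eq: "drop (Suc k) w = v" using Cons by (metis drop_Suc list.sel(3) tl_drop)
    have adj: "distinct_adj v" and dr: "drop 2 (c # v) \<in> \<Omega>"
      using Suc Cons unfolding words_def by (auto simp: distinct_adj_Cons)
    have "drop 2 v \<in> \<Omega>"
    proof (cases "drop 2 (c # v)")
      case Nil
      then have "drop 2 v = []" by simp
      then show ?thesis using assms(1) by (simp add: condition_C1_def)
    next
      case (Cons d u)
      then have "drop 2 v = u" by (metis drop_Suc drop_Suc_Cons list.sel(3) numeral_2_eq_2 tl_drop)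
      then show ?thesis using HH_tl[OF assms(2), of d u] dr Cons by simp
    qed
    then show ?thesis using eq adj by (simp add: words_def)
  qed (use Suc in \<open>simp add: drop_Suc tl_drop\<close>)
qed (use assms in simp)

lemma list_cases_two:
  obtains "v = []" | d where "v = [d]" | d e u where "v = d # e # u"
  by (metis list.exhaust)

text \<open>A word \<open>v c\<close> with \<open>c = 0\<close> is read off from \<open>r\<close>, which is kept. If \<open>c = 1\<close>, subtracting the
  equations \<open>l\<^bsub>\<beta>1\<^esub> + r\<^bsub>\<beta>1\<^esub> = l\<^sub>* r\<^sub>\<beta>\<close> for \<open>l'\<close> and \<open>l\<close> leaves \<open>(l'\<^sub>* - l\<^sub>*) r\<^sub>\<beta>\<close>; here alternation of
  the word is essential: \<open>v\<close> ends in \<open>0\<close>, so \<open>r\<^sub>\<beta>\<close> (and not \<open>l\<^sub>\<beta>\<close>) is its coordinate.\<close>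

lemma coord_step_left:
  assumes "adjacent \<Omega> l r" "adjacent \<Omega> l' r" "v @ [c] \<in> words \<Omega>"
  shows "coord l' r (v @ [c]) =
    coord l r (v @ [c]) + (if c then (l' None - l None) * coord l r v else 0)"
proof (cases c)
  case True
  show ?thesis
  proof (cases v rule: list_cases_two)
    case 1
    then show ?thesis using True by (simp add: coord_def)
  next
    case (2 d)
    then have "\<not> d" using assms(3) True by (simp add: words_def)
    moreover have "l (Some []) = l None * r None - r (Some [])"
      "l' (Some []) = l' None * r None - r (Some [])"
      using assms(1,2) unfolding adjacent_def by (auto simp: algebra_simps)
    ultimately show ?thesis using True 2 by (simp add: coord_def) (simp add: algebra_simps)
  next
    case (3 d e u)
    have "v \<noteq> []" using 3 by simp
    then have nl: "\<not> last v"
      using assms(3) True by (simp add: words_def distinct_adj_append_iff)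
    have "u @ [True] \<in> \<Omega>" using assms(3) True 3 by (simp add: words_def)
    then have "l (Some (u @ [True])) = l None * r (Some u) - r (Some (u @ [True]))"
      "l' (Some (u @ [True])) = l' None * r (Some u) - r (Some (u @ [True]))"
      using assms(1,2) unfolding adjacent_def by (auto simp: algebra_simps)
    moreover have "coord k r (v @ [c]) = k (Some (u @ [True]))" for k
      using True 3 by (simp add: coord_def)
    moreover have "coord l r v = r (Some u)" using 3 nl by (simp add: coord_def)
    ultimately show ?thesis using True by (simp add: left_diff_distrib)
  qed
qed (simp add: coord_def)

lemma coord_step_right:
  assumes "adjacent \<Omega> l r" "adjacent \<Omega> l r'" "v @ [c] \<in> words \<Omega>"
  shows "coord l r' (v @ [c]) =
    coord l r (v @ [c]) + (if \<not> c then (r' None - r None) * coord l r v else 0)"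
proof (cases c)
  case False
  show ?thesis
  proof (cases v rule: list_cases_two)
    case 1
    then show ?thesis using False by (simp add: coord_def)
  next
    case (2 d)
    then have "d" using assms(3) False by (simp add: words_def)
    moreover have "r (Some []) = l None * r None - l (Some [])"
      "r' (Some []) = l None * r' None - l (Some [])"
      using assms(1,2) unfolding adjacent_def by (auto simp: algebra_simps)
    ultimately show ?thesis using False 2 by (simp add: coord_def) (simp add: algebra_simps)
  next
    case (3 d e u)
    have "v \<noteq> []" using 3 by simp
    then have nl: "last v"
      using assms(3) False by (simp add: words_def distinct_adj_append_iff)
    have "u @ [False] \<in> \<Omega>" using assms(3) False 3 by (simp add: words_def)
    then have "r (Some (u @ [False])) = r None * l (Some u) - l (Some (u @ [False]))"
      "r' (Some (u @ [False])) = r' None * l (Some u) - l (Some (u @ [False]))"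
      using assms(1,2) unfolding adjacent_def by (auto simp: algebra_simps)
    moreover have "coord l k (v @ [c]) = k (Some (u @ [False]))" for k
      using False 3 by (simp add: coord_def)
    moreover have "coord l r v = l (Some u)" using 3 nl by (simp add: coord_def)
    ultimately show ?thesis using False by (simp add: left_diff_distrib)
  qed
qed (simp add: coord_def)

text \<open>The convolution formula for the coordinate at \<open>w\<close> contains the coefficient of \<open>w\<close> itself, the
  old coordinate at \<open>w\<close>, and terms with coefficients of proper nonempty suffixes of \<open>w\<close>. The last ones
  vanish by induction, and the new coordinate equals the old one.\<close>

lemma closed_walk_magnus_zero:
  fixes l r :: "nat \<Rightarrow> bitseq option \<Rightarrow> 'a::field"
  assumes C1: "condition_C1 \<Omega>" and HH: "HH False \<Omega> \<union> HH True \<Omega> \<subseteq> \<Omega>"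
    and adj: "\<And>i. adjacent \<Omega> (l i) (r i)"
    and fixed: "\<And>i. if t i then r (Suc i) = r i else l (Suc i) = l i"
    and closed: "l n = l 0" "r n = r 0"
    and w: "w \<in> words \<Omega>" "w \<noteq> []"
  shows "magnus (map (\<lambda>i. (t i, if t i then l (Suc i) None - l i None
    else r (Suc i) None - r i None)) [0..<n]) w = 0"
    (is "magnus ?s w = 0")
  using w
proof (induction "length w" arbitrary: w rule: less_induct)
  case less
  let ?f = "\<lambda>i. coord (l i) (r i)"
  have "?f n w = (\<Sum>j\<le>length w. ?f 0 (take j w) * magnus ?s (drop j w))"
  proof (rule magnus_transport[where P = "words \<Omega>" and f = ?f])
    fix i v c
    assume v: "v @ [c] \<in> words \<Omega>"
    show "?f (Suc i) (v @ [c]) = ?f i (v @ [c]) + (if c = t i then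
        (if t i then l (Suc i) None - l i None else r (Suc i) None - r i None) * ?f i v else 0)"
    proof (cases "t i")
      case True
      then have "r (Suc i) = r i" using fixed[of i] by simp
      then show ?thesis using True coord_step_left[OF adj[of i] _ v, of "l (Suc i)"] adj[of "Suc i"]
        by simp
    next
      case False
      then have "l (Suc i) = l i" using fixed[of i] by simp
      then show ?thesis using False coord_step_right[OF adj[of i] _ v, of "r (Suc i)"] adj[of "Suc i"]
        by simp
    qed
  qed (use less words_butlast[OF C1] in \<open>auto simp: coord_def\<close>)
  also have "\<dots> = (\<Sum>j\<le>length w. (if j = 0 then magnus ?s w else 0) +
      (if j = length w then ?f 0 w else 0))"
  proof (rule sum.cong, goal_cases)
    case (2 j)
    have "magnus ?s (drop j w) = 0" if "j \<noteq> 0" "j \<noteq> length w"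
      using less.hyps[of "drop j w"] words_drop[OF C1 HH less.prems(1)] 2 that by simp
    then show ?case using less.prems(2) by (auto simp: coord_def)
  qed simp
  also have "\<dots> = magnus ?s w + ?f 0 w" by (simp add: sum.distrib)
  finally show ?case using closed by simp
qed

section \<open>Cycles\<close>

text \<open>Given \<open>r\<close> and \<open>l\<^sub>*\<close>, the adjacency equations determine the entries of \<open>l\<close> at longer and longer
  sequences; condition C1 guarantees that no intermediate one is missing. Hence a walk that does not
  turn back has steps of nonzero value.\<close>

lemma adjacent_determines_left:
  fixes l l' r :: "bitseq option \<Rightarrow> 'a::field"
  assumes C1: "condition_C1 \<Omega>" and vec: "l \<in> vectors \<Omega>" "l' \<in> vectors \<Omega>"
    and adj: "adjacent \<Omega> l r" "adjacent \<Omega> l' r" and eq: "l None = l' None"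
  shows "l = l'"
proof -
  have "w \<in> \<Omega> \<longrightarrow> l (Some w) = l' (Some w)" for w
  proof (induction w rule: rev_induct)
    case Nil
    then show ?case using adj eq unfolding adjacent_def by (metis add_right_imp_eq)
  next
    case (snoc c v)
    show ?case
    proof
      assume in\<Omega>: "v @ [c] \<in> \<Omega>"
      then have IH: "l (Some v) = l' (Some v)" using snoc.IH C1_butlast[OF C1] by blast
      have "l (Some (v @ [c])) + r (Some (v @ [c])) = l' (Some (v @ [c])) + r (Some (v @ [c]))"
        using adj in\<Omega> IH eq unfolding adjacent_def by (cases c) auto
      then show "l (Some (v @ [c])) = l' (Some (v @ [c]))" by simp
    qed
  qed
  then show ?thesis using vec eq unfolding vectors_def index_set_def
    by (intro PiE_ext[of _ _ "\<lambda>_. UNIV"]) auto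
qed

lemma adjacent_determines_right:
  fixes l r r' :: "bitseq option \<Rightarrow> 'a::field"
  assumes C1: "condition_C1 \<Omega>" and vec: "r \<in> vectors \<Omega>" "r' \<in> vectors \<Omega>"
    and adj: "adjacent \<Omega> l r" "adjacent \<Omega> l r'" and eq: "r None = r' None"
  shows "r = r'"
proof -
  have "w \<in> \<Omega> \<longrightarrow> r (Some w) = r' (Some w)" for w
  proof (induction w rule: rev_induct)
    case Nil
    then show ?case using adj eq unfolding adjacent_def by (metis add_left_imp_eq)
  next
    case (snoc c v)
    show ?case
    proof
      assume in\<Omega>: "v @ [c] \<in> \<Omega>"
      then have IH: "r (Some v) = r' (Some v)" using snoc.IH C1_butlast[OF C1] by blast
      have "l (Some (v @ [c])) + r (Some (v @ [c])) = l (Some (v @ [c])) + r' (Some (v @ [c]))"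
        using adj in\<Omega> IH eq unfolding adjacent_def by (cases c) auto
      then show "r (Some (v @ [c])) = r' (Some (v @ [c]))" by simp
    qed
  qed
  then show ?thesis using vec eq unfolding vectors_def index_set_def
    by (intro PiE_ext[of _ _ "\<lambda>_. UNIV"]) auto
qed

lemma distinct_adj_bool_nth:
  fixes w :: "bool list"
  assumes "distinct_adj w" "i < length w"
  shows "w ! i = (hd w = even i)"
  using assms(2)
proof (induction i)
  case 0
  then show ?case by (simp add: hd_conv_nth)
next
  case (Suc i)
  then have "w ! i \<noteq> w ! Suc i" using assms(1) by (simp add: distinct_adj_conv_nth)
  then show ?case using Suc by auto
qed

text \<open>Walks are indexed by all natural numbers and periodic, so that neither the closing edge nor a
  change of the starting point needs special treatment. The \<open>i\<close>-th step keeps the vertex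
  \<open>v (i + 1)\<close> and replaces \<open>v i\<close> by \<open>v (i + 2)\<close>; its type is \<open>1\<close> iff \<open>v i\<close> lies in \<open>L(\<Omega>)\<close>.\<close>

lemma no_short_closed_walk:
  fixes v :: "nat \<Rightarrow> (bitseq option \<Rightarrow> 'a::field) + (bitseq option \<Rightarrow> 'a)"
  assumes C1: "condition_C1 \<Omega>" and HH: "HH False \<Omega> \<union> HH True \<Omega> \<subseteq> \<Omega>"
    and edge: "\<And>i. \<exists>l r. {v i, v (Suc i)} = {Inl l, Inr r} \<and>
      l \<in> vectors \<Omega> \<and> r \<in> vectors \<Omega> \<and> adjacent \<Omega> l r"
    and nonback: "\<And>i. v (i + 2) \<noteq> v i"
    and w: "w \<in> words \<Omega>" "w \<noteq> []"
    and closed: "\<And>i. v (i + 2 * length w) = v i"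
    and start: "isl (v 0) = hd w"
  shows False
proof -
  define t where "t i = isl (v i)" for i
  define l where "l i = projl (if t i then v i else v (Suc i))" for i
  define r where "r i = projr (if t i then v (Suc i) else v i)" for i
  define a where "a i = (if t i then l (Suc i) None - l i None else r (Suc i) None - r i None)" for i
  have vs: "(if t i then v i = Inl (l i) \<and> v (Suc i) = Inr (r i)
      else v (Suc i) = Inl (l i) \<and> v i = Inr (r i)) \<and>
      l i \<in> vectors \<Omega> \<and> r i \<in> vectors \<Omega> \<and> adjacent \<Omega> (l i) (r i)" for i
    using edge[of i] unfolding l_def r_def t_def by (auto simp: doubleton_eq_iff)
  have t_Suc: "t (Suc i) = (\<not> t i)" for i
    using vs[of i] unfolding t_def by (auto split: if_splits)
  have t: "t i = (hd w = even i)" for i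
    by (induction i) (use start t_Suc in \<open>auto simp: t_def\<close>)
  have fixed: "if t i then r (Suc i) = r i else l (Suc i) = l i" for i
    using vs[of i] vs[of "Suc i"] t_Suc[of i] by (auto split: if_splits)
  have a: "a i \<noteq> 0" for i
  proof (cases "t i")
    case True
    have "l i \<noteq> l (Suc i)"
      using nonback[of i] vs[of i] vs[of "Suc i"] t_Suc[of i] True by (auto split: if_splits)
    then show ?thesis
      using adjacent_determines_left[OF C1, of "l (Suc i)" "l i" "r i"] vs[of i] vs[of "Suc i"]
        fixed[of i] True by (auto simp: a_def)
  next
    case False
    have "r i \<noteq> r (Suc i)"
      using nonback[of i] vs[of i] vs[of "Suc i"] t_Suc[of i] False by (auto split: if_splits)
    then show ?thesis
      using adjacent_determines_right[OF C1, of "r (Suc i)" "r i" "l i"] vs[of i] vs[of "Suc i"]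
        fixed[of i] False by (auto simp: a_def)
  qed
  let ?m = "length w"
  let ?g = "\<lambda>i. (t i, a i)"
  let ?s = "map ?g [0..<?m]" and ?s' = "map ?g [?m..<2 * ?m]"
  have adj: "distinct_adj w" using w by (simp add: words_def)
  have "v (2 * ?m) = v 0" "v (Suc (2 * ?m)) = v (Suc 0)"
    using closed[of 0] closed[of 1] by simp_all
  then have lr: "l (2 * ?m) = l 0" "r (2 * ?m) = r 0" by (simp_all add: l_def r_def t_def)
  have zero: "magnus (map ?g [0..<2 * ?m]) u = 0" if "u \<in> words \<Omega>" "u \<noteq> []" for u
    using closed_walk_magnus_zero[of \<Omega> l r t, OF C1 HH _ _ lr that] vs fixed
    by (simp add: a_def)
  have "\<exists>j \<in> {1..?m}. magnus (?s @ ?s') (take j w) \<noteq> 0"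
  proof (rule magnus_obstruction)
    show "map fst ?s = w"
      by (rule nth_equalityI) (auto simp: t distinct_adj_bool_nth[OF adj])
    have "last ?s' = ?g (2 * ?m - 1)" using w by (simp add: last_map)
    then show "fst (last ?s') \<noteq> hd w" using w by (simp add: t)
  qed (use adj w a in auto)
  moreover have "?s @ ?s' = map ?g [0..<2 * ?m]"
    using upt_add_eq_append[of 0 ?m ?m] by (simp add: mult_2)
  ultimately show False
    using zero words_take[OF C1 w(1)] w(2) by (metis atLeastAtMost_iff not_one_le_zero take_eq_Nil)
qed

text \<open>A cycle is even as the graph is bipartite, say of length \<open>2m\<close>; if it is too short,
  \<open>\<alpha>\<close> with two bits in front has at least \<open>m\<close> letters.\<close>

lemma cycle_length_bound:
  assumes C1: "condition_C1 \<Omega>" and HH: "HH False \<Omega> \<union> HH True \<Omega> \<subseteq> \<Omega>"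
    and \<alpha>: "\<alpha> \<in> \<Omega> \<inter> U"
    and cycle: "is_cycle (Gamma \<Omega> TYPE('a::{field, finite})) vs"
  shows "2 * (length \<alpha> + 3) \<le> length vs"
proof (rule ccontr)
  assume short: "\<not> ?thesis"
  let ?N = "length vs"
  define v where "v i = vs ! (i mod ?N)" for i
  have N: "3 \<le> ?N" and dist: "distinct vs" using cycle by (auto simp: is_cycle_def)
  have edge: "\<exists>l r. {v i, v (Suc i)} = {Inl l, Inr r} \<and>
      l \<in> vectors \<Omega> \<and> r \<in> vectors \<Omega> \<and> adjacent \<Omega> l r" for i
  proof -
    have "i mod ?N < ?N" using N by (intro mod_less_divisor) linarith
    then have "{vs ! (i mod ?N), vs ! (Suc (i mod ?N) mod ?N)} \<in> snd (Gamma \<Omega> TYPE('a))"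
      using cycle unfolding is_cycle_def by blast
    then show ?thesis unfolding v_def Gamma_def by (auto simp: mod_Suc_eq)
  qed
  have per: "v (i + ?N) = v i" for i by (simp add: v_def)
  have nonback: "v (i + 2) \<noteq> v i" for i
  proof
    assume "v (i + 2) = v i"
    moreover have "j mod ?N < ?N" for j using N by (intro mod_less_divisor) linarith
    ultimately have "(i + 2) mod ?N = i mod ?N"
      using nth_eq_iff_index_eq[OF dist] unfolding v_def by blast
    then have "?N dvd 2" using mod_eq_dvd_iff_nat[of i "i + 2" ?N] by simp
    then show False using N by (auto dest: dvd_imp_le)
  qed
  have alt: "isl (v (Suc i)) = (\<not> isl (v i))" for i
    using edge[of i] by (auto simp: doubleton_eq_iff)
  have isl: "isl (v i) = (isl (v 0) = even i)" for i
    by (induction i) (use alt in auto)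
  have "even ?N" using isl[of ?N] per[of 0] by auto
  then obtain m where m: "?N = 2 * m" by blast
  have m_bounds: "m \<le> length \<alpha> + 2" "m \<noteq> 0" using m short N by auto
  \<comment> \<open>For \<open>\<alpha> = \<eta>\<close> both alternating words of length two stand for a coordinate, so either bit will do.\<close>
  define c where "c = (if \<alpha> = [] then True else hd \<alpha>)"
  define w where "w = take m (c # (\<not> c) # \<alpha>)"
  have "c # (\<not> c) # \<alpha> \<in> words \<Omega>"
    using \<alpha> unfolding words_def c_def U_def by (cases \<alpha>) (auto simp: distinct_adj_Cons)
  then have w: "w \<in> words \<Omega>" unfolding w_def by (rule words_take[OF C1])
  have len: "length w = m" using m_bounds by (simp add: w_def)
  have hd: "hd w = c" using m_bounds by (simp add: w_def)
  \<comment> \<open>Starting at the first or the second vertex decides the side on which the walk begins.\<close>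
  define k :: nat where "k = (if isl (v 0) = c then 0 else 1)"
  show False
  proof (rule no_short_closed_walk[of \<Omega> "\<lambda>i. v (i + k)" w])
    show "v (i + 2 + k) \<noteq> v (i + k)" for i using nonback[of "i + k"] by (simp add: add_ac)
    show "v (i + 2 * length w + k) = v (i + k)" for i
      using per[of "i + k"] m len by (simp add: add_ac)
    show "isl (v (0 + k)) = hd w" using isl[of k] hd by (auto simp: k_def)
    show "w \<noteq> []" using len m_bounds by auto
    show "\<exists>l r. {v (i + k), v (Suc i + k)} = {Inl l, Inr r} \<and>
        l \<in> vectors \<Omega> \<and> r \<in> vectors \<Omega> \<and> adjacent \<Omega> l r" for i
      using edge[of "i + k"] by simp
  qed (use C1 HH w in auto)
qed

theorem theorem11:
  fixes \<Omega> :: "bitseq set" and \<alpha> :: bitseq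
  assumes "finite \<Omega>"
    and "condition_C1 \<Omega>"
    and "HH False \<Omega> \<union> HH True \<Omega> \<subseteq> \<Omega>"
    and "\<alpha> \<in> \<Omega> \<inter> U"
  shows "girth (Gamma \<Omega> TYPE('a::{field, finite})) \<ge> enat (2 * (length \<alpha> + 3))"
  unfolding girth_def using cycle_length_bound[OF assms(2-4)] by (auto intro!: Inf_greatest)

end
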